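(* Let $D\in\mathcal{M}_r(\mathbb{C})$ be diagonal such that $\sigma(D)=\{d_1,d_2\}$ with $|d_1|=|d_2|$. Then the map $R_T:(0,1)\to\mathcal{M}_r(\mathbb{C})$, $R_T(\lambda)=\Delta_\lambda^\infty(T)$, is constant for every $T\in\mathcal{S}(D)$.
   Context: $\mathcal{M}_r(\mathbb{C})$ is the space of complex $r\times r$ matrices; $\sigma(D)$ is the spectrum of $D$. For $T\in\mathcal{M}_r(\mathbb{C})$ with polar decomposition $T=U|T|$, $|T|=(T^*T)^{1/2}$, and $\lambda\in(0,1)$, the $\lambda$-Aluthge transform is $\Delta_\lambda(T)=|T|^\lambda U|T|^{1-\lambda}$, with iterates $\Delta_\lambda^0(T)=T$, $\Delta_\lambda^n(T)=\Delta_\lambda(\Delta_\lambda^{n-1}(T))$. $\Delta_\lambda^\infty(T)=\lim_{n\to\infty}\Delta_\lambda^n(T)$, a limit which exists for every diagonalizable $T$. $\mathcal{S}(D)=\{SDS^{-1}:S\text{ invertible}\}$ is the similarity orbit of $D$. *)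

theory Defs
  imports "HOL-Analysis.Analysis"
begin

definition conj_transpose :: "complex^'n^'m \<Rightarrow> complex^'m^'n" where
  "conj_transpose A = (\<chi> i j. cnj (A $ j $ i))"

definition unitary :: "complex^'n^'n \<Rightarrow> bool" where
  "unitary U \<longleftrightarrow> conj_transpose U ** U = mat 1 \<and> U ** conj_transpose U = mat 1"

definition diag :: "('n \<Rightarrow> complex) \<Rightarrow> complex^'n^'n" where
  "diag d = (\<chi> i j. if i = j then d i else 0)"

definition is_diagonal :: "complex^'n^'n \<Rightarrow> bool" where
  "is_diagonal D \<longleftrightarrow> (\<forall>i j. i \<noteq> j \<longrightarrow> D $ i $ j = 0)"

definition spectrum :: "complex^'n^'n \<Rightarrow> complex set" where
  "spectrum A = {z. \<not> invertible (A - mat z)}"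

definition similarity_orbit :: "complex^'n^'n \<Rightarrow> (complex^'n^'n) set" where
  "similarity_orbit D = {S ** D ** matrix_inv S | S. invertible S}"

text \<open>
  Real powers of a positive semidefinite matrix by functional calculus: if
  \<open>A = V diag(a) V\<^sup>*\<close> with \<open>V\<close> unitary and all \<open>a i \<ge> 0\<close>, then
  \<open>A\<^sup>s = V diag(a\<^sup>s) V\<^sup>*\<close>. The result does not depend on the chosen diagonalization
  (\<open>psd_power_eqI\<close>); for matrices that are not positive semidefinite the value is
  unspecified. Since \<open>0 powr s = 0\<close>, only exponents \<open>s > 0\<close> are meaningful for singular
  matrices.
\<close>

definition is_psd_power :: "complex^'n^'n \<Rightarrow> real \<Rightarrow> complex^'n^'n \<Rightarrow> bool" where
  "is_psd_power A s B \<longleftrightarrow>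
     (\<exists>V a. unitary V \<and> (\<forall>i. 0 \<le> a i) \<and>
        A = V ** diag (\<lambda>i. of_real (a i)) ** conj_transpose V \<and>
        B = V ** diag (\<lambda>i. of_real (a i powr s)) ** conj_transpose V)"

definition psd_power :: "complex^'n^'n \<Rightarrow> real \<Rightarrow> complex^'n^'n" where
  "psd_power A s = (THE B. is_psd_power A s B)"

definition matrix_abs :: "complex^'n^'n \<Rightarrow> complex^'n^'n" where
  "matrix_abs T = psd_power (conj_transpose T ** T) (1/2)"

text \<open>
  The canonical polar decomposition \<open>T = U |T|\<close>: \<open>U\<close> is the partial isometry with the same
  kernel as \<open>T\<close>, which makes it unique; it is unitary if \<open>T\<close> is invertible.
\<close>

definition is_polar_factor :: "complex^'n^'n \<Rightarrow> complex^'n^'n \<Rightarrow> bool" where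
  "is_polar_factor T U \<longleftrightarrow>
     T = U ** matrix_abs T \<and>
     U ** conj_transpose U ** U = U \<and>
     {x. U *v x = 0} = {x. T *v x = 0}"

definition polar_factor :: "complex^'n^'n \<Rightarrow> complex^'n^'n" where
  "polar_factor T = (THE U. is_polar_factor T U)"

definition aluthge :: "real \<Rightarrow> complex^'n^'n \<Rightarrow> complex^'n^'n" where
  "aluthge l T =
     psd_power (matrix_abs T) l ** polar_factor T ** psd_power (matrix_abs T) (1 - l)"

definition aluthge_iter :: "real \<Rightarrow> nat \<Rightarrow> complex^'n^'n \<Rightarrow> complex^'n^'n" where
  "aluthge_iter l n T = (aluthge l ^^ n) T"

definition aluthge_limit :: "real \<Rightarrow> complex^'n^'n \<Rightarrow> complex^'n^'n" where
  "aluthge_limit l T = lim (\<lambda>n. aluthge_iter l n T)"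

lemma diag_mult_nth: "(diag d ** A) $ i $ j = d i * A $ i $ j"
  by (simp add: matrix_matrix_mult_def diag_def if_distrib[of "\<lambda>x. x * _"] cong: if_cong)

lemma mult_diag_nth: "(A ** diag d) $ i $ j = A $ i $ j * d j"
  by (simp add: matrix_matrix_mult_def diag_def if_distrib[of "\<lambda>x. _ * x"] cong: if_cong)

lemma is_psd_power_unique:
  fixes A :: "complex^'n^'n"
  assumes "is_psd_power A s B" "is_psd_power A s C"
  shows "B = C"
proof -
  obtain V a where V: "unitary V"
    and A1: "A = V ** diag (\<lambda>i. of_real (a i)) ** conj_transpose V"
    and B: "B = V ** diag (\<lambda>i. of_real (a i powr s)) ** conj_transpose V"
    using assms(1) unfolding is_psd_power_def by blast
  obtain W b where W: "unitary W"
    and A2: "A = W ** diag (\<lambda>i. of_real (b i)) ** conj_transpose W"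
    and C: "C = W ** diag (\<lambda>i. of_real (b i powr s)) ** conj_transpose W"
    using assms(2) unfolding is_psd_power_def by blast
  have V': "conj_transpose V ** V = mat 1" "V ** conj_transpose V = mat 1"
    and W': "conj_transpose W ** W = mat 1" "W ** conj_transpose W = mat 1"
    using V W by (auto simp: unitary_def)
  define X where "X = conj_transpose W ** V"
  have mid: "conj_transpose W ** (V ** E ** conj_transpose V) ** V = X ** E" for E
    unfolding X_def by (metis V'(1) matrix_mul_assoc matrix_mul_rid)
  have mid': "conj_transpose W ** (W ** E ** conj_transpose W) ** V = E ** X" for E
    unfolding X_def by (metis W'(1) matrix_mul_assoc matrix_mul_lid)
  have "X ** diag (\<lambda>i. of_real (a i)) = diag (\<lambda>i. of_real (b i)) ** X"
    using A1 A2 mid mid' by metis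
  then have e: "X $ i $ j * of_real (a j) = of_real (b i) * X $ i $ j" for i j
    by (metis diag_mult_nth mult_diag_nth)
  have "X $ i $ j * of_real (a j powr s) = of_real (b i powr s) * X $ i $ j" for i j
    using e[of i j] by (cases "X $ i $ j = 0") (auto simp: mult.commute)
  then have "X ** diag (\<lambda>i. of_real (a i powr s)) = diag (\<lambda>i. of_real (b i powr s)) ** X"
    by (simp add: vec_eq_iff diag_mult_nth mult_diag_nth)
  then have "conj_transpose W ** B ** V = conj_transpose W ** C ** V"
    unfolding B C mid mid' .
  then show "B = C"
    by (metis V'(2) W'(2) matrix_mul_assoc matrix_mul_lid matrix_mul_rid)
qed

lemma psd_power_eqI: "is_psd_power A s B \<Longrightarrow> psd_power A s = B"
  unfolding psd_power_def by (blast intro: is_psd_power_unique)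

end

theory Submission
  imports Defs
begin

text \<open>
  After scaling by \<open>w\<close> with \<open>w\<^sup>2 = d1 d2\<close> the matrix satisfies \<open>T\<^sup>2 + 1 = 2 c T\<close> with \<open>c\<close> real and
  \<open>c\<^sup>2 \<le> 1\<close>, a relation preserved by similarity and hence by the Aluthge transform. Write
  \<open>T = c + H + K\<close> with \<open>H\<close> Hermitian and \<open>K\<close> skew-Hermitian; then \<open>H\<^sup>2 = - K\<^sup>2 - (1 - c\<^sup>2)\<close>. The relation
  forces the skew part of the polar factor \<open>U\<close> to anticommute with \<open>log |T|\<close>, and it follows that
  the transform multiplies \<open>K\<close> by a positive function of \<open>- K\<^sup>2\<close>. So the eigenvectors of \<open>K\<close> are fixed
  along the iteration, while each eigenvalue \<open>\<i> k\<close> keeps its sign and \<open>k\<^sup>2\<close> decreases to \<open>1 - c\<^sup>2\<close>.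
  Hence \<open>H\<close> tends to 0, and the limit \<open>c + \<surd>(1 - c\<^sup>2) K (- K\<^sup>2)\<^sup>-\<^sup>1\<^sup>/\<^sup>2\<close> (with the sign of \<open>k\<close> read
  as 0 at 0) does not involve \<open>\<lambda>\<close>.
\<close>

section \<open>Matrix algebra\<close>

lemma conj_transpose_nth [simp]: "conj_transpose A $ i $ j = cnj (A $ j $ i)"
  by (simp add: conj_transpose_def)

lemma matrix_mult_nth: "(A ** B) $ i $ j = (\<Sum>k\<in>UNIV. A $ i $ k * B $ k $ j)"
  by (simp add: matrix_matrix_mult_def)

lemma diag_nth: "diag d $ i $ j = (if i = j then d i else 0)"
  by (simp add: diag_def)

lemma mat_eq_diag: "mat z = diag (\<lambda>_. z)"
  by (simp add: mat_def diag_def)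

lemma diag_mult_diag: "diag a ** diag b = diag (\<lambda>i. a i * b i)"
  by (simp add: vec_eq_iff diag_mult_nth diag_nth)

lemma conj_transpose_mult: "conj_transpose (A ** B) = conj_transpose B ** conj_transpose A"
  by (simp add: vec_eq_iff matrix_mult_nth mult.commute)

lemma conj_transpose_invol [simp]: "conj_transpose (conj_transpose A) = A"
  by (simp add: vec_eq_iff)

lemma conj_transpose_diag: "conj_transpose (diag d) = diag (\<lambda>i. cnj (d i))"
  by (auto simp: vec_eq_iff diag_nth)

lemma conj_transpose_mat [simp]: "conj_transpose (mat z) = mat (cnj z)"
  by (simp add: mat_eq_diag conj_transpose_diag)

lemma mat_mult_commute: "A ** mat z = mat z ** (A :: complex^'n^'n)"
  by (simp add: vec_eq_iff mat_eq_diag diag_mult_nth mult_diag_nth)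

lemma matrix_add_rdistrib: "(B + C) ** A = B ** A + (C :: complex^'n^'n) ** A"
  by (simp add: vec_eq_iff matrix_mult_nth algebra_simps sum.distrib)

lemma matrix_diff_ldistrib: "A ** (B - C) = A ** B - A ** (C :: complex^'n^'n)"
  by (simp add: vec_eq_iff matrix_mult_nth algebra_simps sum_subtractf)

lemma matrix_diff_rdistrib: "(B - C) ** A = B ** A - (C :: complex^'n^'n) ** A"
  by (simp add: vec_eq_iff matrix_mult_nth algebra_simps sum_subtractf)

lemma unitary_mult: "unitary A \<Longrightarrow> unitary B \<Longrightarrow> unitary (A ** B)"
  unfolding unitary_def conj_transpose_mult
  by (metis matrix_mul_assoc matrix_mul_lid)

lemma unitary_conj_transpose: "unitary A \<Longrightarrow> unitary (conj_transpose A)"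
  by (simp add: unitary_def)

lemma unitary_mat_1 [simp]: "unitary (mat 1)"
  by (simp add: unitary_def mat_eq_diag conj_transpose_diag diag_mult_diag)

lemma unitaryI: "conj_transpose U ** U = mat 1 \<Longrightarrow> unitary U"
  unfolding unitary_def using matrix_left_right_inverse by blast

section \<open>Unitary conjugation and the functional calculus of diagonalized matrices\<close>

definition conj_by :: "complex^'n^'n \<Rightarrow> complex^'n^'n \<Rightarrow> complex^'n^'n" where
  "conj_by V A = V ** A ** conj_transpose V"

lemma conj_by_mult:
  assumes "unitary V" shows "conj_by V A ** conj_by V B = conj_by V (A ** B)"
proof -
  have "conj_transpose V ** V = mat 1" using assms by (simp add: unitary_def)
  then show ?thesis unfolding conj_by_def by (metis matrix_mul_assoc matrix_mul_lid)
qed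

lemma conj_by_mat [simp]: "unitary V \<Longrightarrow> conj_by V (mat z) = mat z"
  unfolding conj_by_def mat_mult_commute
  by (simp add: unitary_def flip: matrix_mul_assoc)

lemma conj_by_conj_by: "conj_by V (conj_by W A) = conj_by (V ** W) A"
  by (simp add: conj_by_def conj_transpose_mult matrix_mul_assoc)

lemma conj_by_inverse [simp]:
  "unitary V \<Longrightarrow> conj_by V (conj_by (conj_transpose V) A) = A"
  "unitary V \<Longrightarrow> conj_by (conj_transpose V) (conj_by V A) = A"
  by (simp_all add: conj_by_conj_by unitary_def) (simp_all add: conj_by_def)

lemma conj_by_diff: "conj_by V (A - B) = conj_by V A - conj_by V B"
  by (simp add: conj_by_def matrix_diff_ldistrib matrix_diff_rdistrib)

lemma conj_by_scaleR: "conj_by V (r *\<^sub>R A) = r *\<^sub>R conj_by V A"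
  by (simp add: conj_by_def matrix_scalar_ac flip: scalar_matrix_assoc)

lemma conj_by_mat_mult: "conj_by V (mat z ** A) = mat z ** conj_by V A"
  unfolding conj_by_def by (metis mat_mult_commute matrix_mul_assoc)

lemma conj_transpose_conj_by: "conj_transpose (conj_by V A) = conj_by V (conj_transpose A)"
  by (simp add: conj_by_def conj_transpose_mult matrix_mul_assoc)

lemma unitary_conj_by: "unitary V \<Longrightarrow> unitary U \<Longrightarrow> unitary (conj_by V U)"
  unfolding conj_by_def by (intro unitary_mult unitary_conj_transpose)

lemma tendsto_conj_by: "X \<longlonglongrightarrow> A \<Longrightarrow> (\<lambda>n. conj_by V (X n)) \<longlonglongrightarrow> conj_by V A"
  unfolding conj_by_def
  by (intro vec_tendstoI) (auto simp: matrix_mult_nth intro!: tendsto_intros tendsto_vec_nth)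

text \<open>The intertwiner \<open>X\<close> of the two diagonal matrices has a nonzero entry at
  \<open>i\<close>, \<open>j\<close> only when \<open>a j = b i\<close>, so it also intertwines
  their images under \<open>f\<close>. This later allows a function of the squared skew part to be
  evaluated in two different eigenbases.\<close>

lemma diagonal_calculus_unique:
  assumes V: "unitary V" and W: "unitary W"
    and eq: "conj_by V (diag (\<lambda>i. of_real (a i))) = conj_by W (diag (\<lambda>i. of_real (b i)))"
  shows "conj_by V (diag (\<lambda>i. of_real (f (a i)))) = conj_by W (diag (\<lambda>i. of_real (f (b i))))"
proof -
  define X where "X = conj_transpose W ** V"
  have XX: "X ** conj_transpose X = mat 1"
    using unitary_mult[OF unitary_conj_transpose[OF W] V] by (simp add: X_def unitary_def)
  have X'X: "conj_transpose X ** X = mat 1"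
    using unitary_mult[OF unitary_conj_transpose[OF W] V] by (simp add: X_def unitary_def)
  have "conj_by X (diag (\<lambda>i. of_real (a i))) = diag (\<lambda>i. of_real (b i))"
    unfolding X_def using eq W by (simp flip: conj_by_conj_by)
  then have "X ** diag (\<lambda>i. of_real (a i)) = diag (\<lambda>i. of_real (b i)) ** X"
    unfolding conj_by_def by (metis X'X matrix_mul_assoc matrix_mul_rid)
  then have e: "X $ i $ j * of_real (a j) = of_real (b i) * X $ i $ j" for i j
    by (metis diag_mult_nth mult_diag_nth)
  have "X $ i $ j * of_real (f (a j)) = of_real (f (b i)) * X $ i $ j" for i j
    using e[of i j] by (cases "X $ i $ j = 0") (auto simp: mult.commute)
  then have "X ** diag (\<lambda>i. of_real (f (a i))) = diag (\<lambda>i. of_real (f (b i))) ** X"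
    by (simp add: vec_eq_iff diag_mult_nth mult_diag_nth)
  then have "conj_by X (diag (\<lambda>i. of_real (f (a i)))) = diag (\<lambda>i. of_real (f (b i)))"
    unfolding conj_by_def by (metis XX matrix_mul_assoc matrix_mul_rid)
  then have "conj_by W (conj_by X (diag (\<lambda>i. of_real (f (a i))))) = conj_by W (diag (\<lambda>i. of_real (f (b i))))"
    by simp
  then show ?thesis
    unfolding X_def using W by (simp flip: conj_by_conj_by)
qed

section \<open>The spectral theorem for Hermitian matrices\<close>

text \<open>On \<open>complex^'n\<close>, \<open>inner\<close> is only the real part of this form.
  Orthogonality over the complex numbers needs the sesquilinear form itself, which is linear in its
  second argument.\<close>

definition hip :: "complex^'n \<Rightarrow> complex^'n \<Rightarrow> complex" where
  "hip x y = (\<Sum>i\<in>UNIV. cnj (x $ i) * y $ i)"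

lemma inner_eq_Re_hip: "inner x y = Re (hip x y)"
  by (simp add: hip_def inner_vec_def inner_complex_def)

lemma hip_cnj: "cnj (hip x y) = hip y x"
  by (simp add: hip_def mult.commute)

lemma hip_add_right: "hip x (y + z) = hip x y + hip x z"
  by (simp add: hip_def distrib_left sum.distrib)

lemma hip_diff_right: "hip x (y - z) = hip x y - hip x z"
  by (simp add: hip_def right_diff_distrib sum_subtractf)

lemma hip_scaleR_right: "hip x (r *\<^sub>R y) = r *\<^sub>R hip x y"
  by (simp add: hip_def scaleR_sum_right)

lemma hip_scale_right: "hip x (c *s y) = c * hip x y"
  by (simp add: hip_def sum_distrib_left mult.left_commute)

lemma hip_self: "hip x x = of_real ((norm x)\<^sup>2)"
  by (metis hip_cnj complex_eq_iff Re_complex_of_real Im_complex_of_real complex_cnj_cancel_iff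
      inner_eq_Re_hip power2_norm_eq_inner Reals_cnj_iff complex_is_Real_iff)

lemma hip_hermitian:
  assumes "conj_transpose A = A" shows "hip (A *v x) y = hip x (A *v y)"
proof -
  have c: "cnj (A $ i $ j) = A $ j $ i" for i j
    using assms by (metis conj_transpose_nth)
  have "hip (A *v x) y = (\<Sum>i\<in>UNIV. \<Sum>j\<in>UNIV. A $ j $ i * cnj (x $ j) * y $ i)"
    by (simp add: hip_def matrix_vector_mult_def sum_distrib_right c)
  also have "\<dots> = hip x (A *v y)"
    by (subst sum.swap) (simp add: hip_def matrix_vector_mult_def sum_distrib_left mult.assoc mult.left_commute)
  finally show ?thesis .
qed

text \<open>First-order condition at the minimum \<open>t = 0\<close>. If \<open>b\<close> were
  nonzero, the point \<open>t = - b / q\<close> with \<open>q > r\<close> would make the quadratic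
  negative.\<close>

lemma linear_coefficient_zero:
  fixes b r :: real
  assumes "\<And>t. 0 \<le> t * b + t\<^sup>2 * r"
  shows "b = 0"
proof (rule ccontr)
  assume "b \<noteq> 0"
  define q where "q = \<bar>r\<bar> + 1"
  have q: "q > 0" "r < q" by (auto simp: q_def)
  have "(- b / q) * b + (- b / q)\<^sup>2 * r = (b / q)\<^sup>2 * (r - q)"
    using q by (simp add: field_simps power2_eq_square)
  moreover have "(b / q)\<^sup>2 * (r - q) < 0"
    using q \<open>b \<noteq> 0\<close> by (intro mult_pos_neg) auto
  ultimately show False using assms[of "- b / q"] by linarith
qed

text \<open>The eigenvector maximizes the quadratic form on the unit sphere of the invariant subspace
  orthogonal to the vectors \<open>v i\<close>.\<close>

lemma hermitian_eigenvector_orthogonal: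
  fixes A :: "complex^'n^'n" and S :: "'n set"
  assumes A: "conj_transpose A = A" and "n \<notin> S"
    and ev: "\<And>i. i \<in> S \<Longrightarrow> A *v v i = (of_real (a i) :: complex) *s v i"
  obtains x m where "norm x = 1" "A *v x = of_real m *s x" "\<And>i. i \<in> S \<Longrightarrow> hip (v i) x = 0"
proof -
  define W where "W = {x. \<forall>i\<in>S. hip (v i) x = 0}"
  have cont [continuous_intros]: "continuous_on UNIV (hip u)" for u :: "complex^'n"
    unfolding hip_def by (intro continuous_intros)
  have contA [continuous_intros]: "continuous_on UNIV ((*v) A)"
    using matrix_vector_mul_bounded_linear linear_continuous_on by blast
  have Ascale: "A *v (r *\<^sub>R y) = r *\<^sub>R (A *v y)" for r y
    by (rule linear_cmul[OF matrix_vector_mul_linear])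
  have closedW: "closed W"
  proof -
    have "W = (\<Inter>i\<in>S. {x. hip (v i) x = 0})" by (auto simp: W_def)
    moreover have "closed {x. hip (v i) x = 0}" for i
      by (intro closed_Collect_eq cont continuous_intros)
    ultimately show ?thesis by auto
  qed
  have Wadd: "x + y \<in> W" if "x \<in> W" "y \<in> W" for x y
    using that by (simp add: W_def hip_add_right)
  have Wdiff: "x - y \<in> W" if "x \<in> W" "y \<in> W" for x y
    using that by (simp add: W_def hip_diff_right)
  have Wscale: "r *\<^sub>R x \<in> W" if "x \<in> W" for x r
    using that by (simp add: W_def hip_scaleR_right)
  have WA: "A *v x \<in> W" if "x \<in> W" for x
  proof -
    have "hip (v i) (A *v x) = 0" if "i \<in> S" for i
    proof -
      have "hip (v i) (A *v x) = cnj (hip x (A *v v i))"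
        by (simp add: hip_cnj hip_hermitian[OF A])
      also have "\<dots> = of_real (a i) * hip (v i) x"
        by (simp add: ev[OF that] hip_scale_right hip_cnj)
      finally show ?thesis using \<open>x \<in> W\<close> that by (simp add: W_def)
    qed
    then show ?thesis by (simp add: W_def)
  qed
  \<comment> \<open>The rows of \<open>B\<close> indexed by \<open>S\<close> are the conjugates of
    the vectors \<open>v i\<close>, and all other rows vanish. Row \<open>n\<close> is among the
    latter, so \<open>B\<close> is singular, and a kernel vector is orthogonal to every
    \<open>v i\<close>.\<close>
  obtain x0 where x0: "x0 \<in> W" "x0 \<noteq> 0"
  proof -
    define B :: "complex^'n^'n" where "B = (\<chi> i j. if i \<in> S then cnj (v i $ j) else 0)"
    have "row n B = 0" using \<open>n \<notin> S\<close> by (simp add: row_def B_def vec_eq_iff)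
    then have "det B = 0" by (rule det_zero_row)
    then have "\<nexists>C. C ** B = mat 1"
      using invertible_det_nz invertible_left_inverse by blast
    then obtain x where "B *v x = 0" "x \<noteq> 0" unfolding matrix_left_invertible_ker by blast
    moreover have "(B *v x) $ i = hip (v i) x" if "i \<in> S" for i
      using that by (simp add: B_def matrix_vector_mult_def hip_def)
    ultimately have "x \<in> W" by (simp add: W_def vec_eq_iff)
    with \<open>x \<noteq> 0\<close> show ?thesis by (rule that[rotated])
  qed
  define q where "q = (\<lambda>x. inner x (A *v x))"
  have "compact (W \<inter> sphere 0 1)" using closedW by (simp add: closed_Int_compact)
  moreover have "(1 / norm x0) *\<^sub>R x0 \<in> W \<inter> sphere 0 1" using x0 Wscale by auto
  moreover have "continuous_on (W \<inter> sphere 0 1) q"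
    unfolding q_def by (intro continuous_intros continuous_on_subset[OF contA]) auto
  ultimately obtain x where x: "x \<in> W" "norm x = 1" and max: "\<And>y. y \<in> W \<inter> sphere 0 1 \<Longrightarrow> q y \<le> q x"
    using continuous_attains_sup[of "W \<inter> sphere 0 1" q] by fastforce
  define m where "m = q x"
  have le: "q y \<le> m * (norm y)\<^sup>2" if "y \<in> W" for y
  proof (cases "y = 0")
    case False
    then have "q ((1 / norm y) *\<^sub>R y) \<le> m"
      unfolding m_def using that Wscale by (intro max) auto
    moreover have "q ((1 / norm y) *\<^sub>R y) = q y / (norm y)\<^sup>2"
      by (simp add: q_def Ascale power2_eq_square)
    ultimately show ?thesis using False by (simp add: field_simps)
  qed (simp add: q_def)
  \<comment> \<open>\<open>y\<close> is the residual of the eigenvalue equation. It lies in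
    \<open>W\<close>, so \<open>x\<close> may be perturbed along \<open>y\<close>. The first
    variation of \<open>m * (norm _)\<^sup>2 - q\<close> in this direction is
    \<open>2 * inner y y\<close>, and it vanishes because this function is nonnegative on
    \<open>W\<close> and zero at \<open>x\<close>.\<close>
  define y where "y = m *\<^sub>R x - A *v x"
  have yW: "y \<in> W" unfolding y_def using x by (intro Wdiff Wscale WA)
  have sym: "inner u (A *v w) = inner w (A *v u)" for u w
    by (metis A hip_hermitian inner_commute inner_eq_Re_hip)
  have "2 * inner y y = 0"
  proof (rule linear_coefficient_zero)
    fix t :: real
    have "q (x + t *\<^sub>R y) \<le> m * (norm (x + t *\<^sub>R y))\<^sup>2"
      using x yW by (intro le Wadd Wscale)
    moreover have "q (x + t *\<^sub>R y) = m + 2 * t * inner y (A *v x) + t\<^sup>2 * q y"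
      by (simp add: q_def m_def matrix_vector_right_distrib Ascale inner_add sym[of x y] power2_eq_square algebra_simps)
    moreover have "(norm (x + t *\<^sub>R y))\<^sup>2 = 1 + 2 * t * inner y x + t\<^sup>2 * (norm y)\<^sup>2"
      using x(2) unfolding power2_norm_eq_inner norm_eq_1
      by (simp add: inner_add inner_commute power2_eq_square algebra_simps)
    moreover have "t * inner y y = t * (m * inner y x - inner y (A *v x))"
      by (subst (2) y_def) (simp add: inner_diff_right)
    ultimately show "0 \<le> t * (2 * inner y y) + t\<^sup>2 * (m * (norm y)\<^sup>2 - q y)"
      by (simp add: algebra_simps)
  qed
  then have "A *v x = m *\<^sub>R x" by (simp add: y_def)
  also have "\<dots> = of_real m *s x" by (simp add: vec_eq_iff scaleR_conv_of_real[where 'a = complex])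
  finally show ?thesis using that x by (auto simp: W_def)
qed

text \<open>Induction over subsets of the index type adds one orthonormal eigenvector per index. For
  the full index set these vectors are the columns of \<open>V\<close>.\<close>

theorem hermitian_diagonalization:
  fixes A :: "complex^'n^'n"
  assumes A: "conj_transpose A = A"
  obtains V a where "unitary V" "A = conj_by V (diag (\<lambda>i. of_real (a i)))"
proof -
  have "\<exists>v a. (\<forall>i\<in>S. \<forall>j\<in>S. hip (v i) (v j) = (if i = j then 1 else 0)) \<and>
      (\<forall>i\<in>S. A *v v i = (of_real (a i) :: complex) *s v i)" for S :: "'n set"
    using finite[of S]
  proof induction
    case (insert n S)
    then obtain v a where o: "\<And>i j. i \<in> S \<Longrightarrow> j \<in> S \<Longrightarrow> hip (v i) (v j) = (if i = j then 1 else 0)"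
      and e: "\<And>i. i \<in> S \<Longrightarrow> A *v v i = (of_real (a i) :: complex) *s v i" by blast
    obtain x m where x: "norm x = 1" "A *v x = of_real m *s x" "\<And>i. i \<in> S \<Longrightarrow> hip (v i) x = 0"
      using hermitian_eigenvector_orthogonal[OF A \<open>n \<notin> S\<close>, of v a] e by blast
    have "hip x (v i) = 0" if "i \<in> S" for i
      using x(3)[OF that] by (metis hip_cnj complex_cnj_zero)
    moreover have "hip x x = 1" by (simp add: hip_self x(1))
    ultimately show ?case
      using insert.hyps o e x
      by (intro exI[of _ "v(n := x)"] exI[of _ "a(n := m)"]) auto
  qed simp
  from this[of UNIV] obtain v :: "'n \<Rightarrow> complex^'n" and a where o: "\<And>i j. hip (v i) (v j) = (if i = j then 1 else 0)"
    and e: "\<And>i. A *v v i = (of_real (a i) :: complex) *s v i" by blast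
  define V :: "complex^'n^'n" where "V = (\<chi> i j. v j $ i)"
  have "conj_transpose V ** V = mat 1"
    using o by (simp add: vec_eq_iff matrix_mult_nth V_def mat_def hip_def)
  then have V: "unitary V" by (rule unitaryI)
  have "(A ** V) $ i $ j = (A *v v j) $ i" for i j
    by (simp add: V_def matrix_mult_nth matrix_vector_mult_def)
  then have "A ** V = V ** diag (\<lambda>i. of_real (a i))"
    by (simp add: vec_eq_iff e mult_diag_nth V_def mult.commute)
  then have "A = conj_by V (diag (\<lambda>i. of_real (a i)))"
    using V unfolding conj_by_def unitary_def by (metis matrix_mul_assoc matrix_mul_rid)
  with V show ?thesis by (rule that)
qed

section \<open>Polar decomposition and the Aluthge transform\<close>

abbreviation rdiag :: "('n \<Rightarrow> real) \<Rightarrow> complex^'n^'n" where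
  "rdiag p \<equiv> diag (\<lambda>i. of_real (p i))"

lemma is_psd_power_conj_by:
  assumes "unitary W" "\<And>i. 0 \<le> p i"
  shows "is_psd_power (conj_by W (rdiag p)) s (conj_by W (rdiag (\<lambda>i. p i powr s)))"
  using assms unfolding is_psd_power_def conj_by_def by blast

text \<open>With \<open>Q\<close> the inverse of \<open>matrix_abs T\<close>, the only candidate for
  a polar factor is \<open>T ** Q\<close>. The kernel condition holds because both kernels are
  trivial.\<close>

lemma polar_factor_eqI:
  assumes U: "unitary U" and T: "T = U ** matrix_abs T" and inv: "invertible (matrix_abs T)"
  shows "polar_factor T = U"
  unfolding polar_factor_def
proof (rule the_equality)
  obtain Q where Q: "matrix_abs T ** Q = mat 1" "Q ** matrix_abs T = mat 1"
    using inv unfolding invertible_def by blast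
  have UU: "conj_transpose U ** U = mat 1" "U ** conj_transpose U = mat 1"
    using U by (auto simp: unitary_def)
  have U0: "U *v x = 0 \<longleftrightarrow> x = 0" for x
    by (metis UU(1) matrix_left_invertible_ker matrix_vector_mult_0_right)
  have T0: "T *v x = 0 \<longleftrightarrow> x = 0" for x
    by (metis Q(2) T U0 matrix_left_invertible_ker matrix_vector_mul_assoc matrix_vector_mult_0_right)
  show "is_polar_factor T U"
    unfolding is_polar_factor_def using T UU by (simp add: U0 T0)
  fix U' assume "is_polar_factor T U'"
  then have "T = U' ** matrix_abs T" by (simp add: is_polar_factor_def)
  then have "U' = T ** Q" by (metis Q(1) matrix_mul_assoc matrix_mul_rid)
  moreover have "U = T ** Q" using T by (metis Q(1) matrix_mul_assoc matrix_mul_rid)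
  ultimately show "U' = U" by simp
qed

text \<open>The Gram matrix of \<open>T\<close> is the square of the positive definite factor, which
  identifies that factor as \<open>matrix_abs T\<close> and then \<open>U\<close> as the polar
  factor. The definite descriptions behind \<open>aluthge\<close> thus give way to an explicit
  product.\<close>

lemma aluthge_polar:
  assumes W: "unitary W" and U: "unitary U" and p: "\<And>i. 0 < p i"
    and T: "T = U ** conj_by W (rdiag p)"
  shows "aluthge l T = conj_by W (rdiag (\<lambda>i. p i powr l)) ** U ** conj_by W (rdiag (\<lambda>i. p i powr (1 - l)))"
proof -
  have UU: "conj_transpose U ** U = mat 1" using U by (simp add: unitary_def)
  have "conj_transpose T ** T = conj_by W (rdiag p) ** (conj_transpose U ** U) ** conj_by W (rdiag p)"
    by (simp add: T conj_transpose_mult conj_transpose_conj_by conj_transpose_diag matrix_mul_assoc)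
  also have "\<dots> = conj_by W (rdiag (\<lambda>i. (p i)\<^sup>2))"
    by (simp add: UU conj_by_mult[OF W] diag_mult_diag power2_eq_square)
  finally have TT: "conj_transpose T ** T = conj_by W (rdiag (\<lambda>i. (p i)\<^sup>2))" .
  have "((p i)\<^sup>2) powr (1/2) = p i" for i
    using p[of i] by (simp add: powr_half_sqrt)
  then have P: "matrix_abs T = conj_by W (rdiag p)"
    unfolding matrix_abs_def TT
    using psd_power_eqI[OF is_psd_power_conj_by[OF W, of "\<lambda>i. (p i)\<^sup>2" "1/2"]] by simp
  have pw: "psd_power (matrix_abs T) s = conj_by W (rdiag (\<lambda>i. p i powr s))" for s
    unfolding P using p by (intro psd_power_eqI is_psd_power_conj_by W) (simp add: less_imp_le)
  have "conj_by W (rdiag (\<lambda>i. 1 / p i)) ** conj_by W (rdiag p) = mat 1"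
    using p by (simp add: conj_by_mult[OF W] diag_mult_diag less_imp_neq[THEN not_sym] W flip: mat_eq_diag)
  then have "invertible (matrix_abs T)"
    unfolding P by (auto simp: invertible_left_inverse)
  then have "polar_factor T = U"
    using U T P by (intro polar_factor_eqI) auto
  then show ?thesis by (simp add: aluthge_def pw)
qed

text \<open>If \<open>W\<close> diagonalizes the Gram matrix of \<open>T\<close>, the columns of
  \<open>X = T ** W\<close> are orthogonal with squared lengths \<open>a i\<close>, which are
  positive since \<open>X\<close> is invertible. Dividing the columns by their lengths yields a
  unitary matrix.\<close>

lemma polar_decomposition:
  fixes T :: "complex^'n^'n"
  assumes "invertible T"
  obtains W p U where "unitary W" "unitary U" "\<And>i. 0 < p i" "T = U ** conj_by W (rdiag p)"
proof -
  have "conj_transpose (conj_transpose T ** T) = conj_transpose T ** T"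
    by (simp add: conj_transpose_mult)
  then obtain W a where W: "unitary W" and TT: "conj_transpose T ** T = conj_by W (rdiag a)"
    by (rule hermitian_diagonalization)
  have W': "conj_transpose W ** W = mat 1" "W ** conj_transpose W = mat 1"
    using W by (auto simp: unitary_def)
  define X where "X = T ** W"
  have XX: "conj_transpose X ** X = rdiag a"
  proof -
    have "conj_transpose X ** X = conj_by (conj_transpose W) (conj_transpose T ** T)"
      by (simp add: X_def conj_by_def conj_transpose_mult matrix_mul_assoc)
    then show ?thesis using W by (simp add: TT)
  qed
  have pos: "0 < a i" for i
  proof -
    have "of_real (a i) = (conj_transpose X ** X) $ i $ i" by (simp add: XX diag_nth)
    also have "\<dots> = of_real (\<Sum>k\<in>UNIV. (cmod (X $ k $ i))\<^sup>2)"
      by (simp add: matrix_mult_nth mult.commute flip: complex_norm_square)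
    finally have ai: "a i = (\<Sum>k\<in>UNIV. (cmod (X $ k $ i))\<^sup>2)" by (simp only: of_real_eq_iff)
    obtain Y where "Y ** X = mat 1"
      unfolding X_def using assms W' by (metis invertible_def matrix_mul_assoc matrix_mul_rid)
    then have "(Y ** X) $ i $ i = 1" by (simp add: mat_def)
    then obtain k where "X $ k $ i \<noteq> 0"
      unfolding matrix_mult_nth by (metis (no_types, lifting) mult_zero_right sum.neutral zero_neq_one)
    then show ?thesis unfolding ai
      by (intro sum_pos2[of _ k]) auto
  qed
  define p where "p = (\<lambda>i. sqrt (a i))"
  have p: "0 < p i" "p i * p i = a i" for i using pos[of i] by (auto simp: p_def)
  define U where "U = X ** rdiag (\<lambda>i. 1 / p i) ** conj_transpose W"
  have "conj_transpose (X ** rdiag (\<lambda>i. 1 / p i)) ** (X ** rdiag (\<lambda>i. 1 / p i))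
      = rdiag (\<lambda>i. 1 / p i) ** (conj_transpose X ** X) ** rdiag (\<lambda>i. 1 / p i)"
    by (simp add: conj_transpose_mult conj_transpose_diag matrix_mul_assoc)
  also have "\<dots> = mat 1"
    unfolding XX mat_eq_diag diag_mult_diag p(2)[symmetric]
    using p(1) by (simp add: less_imp_neq[THEN not_sym])
  finally have "unitary (X ** rdiag (\<lambda>i. 1 / p i))" by (rule unitaryI)
  then have "unitary U" unfolding U_def
    by (rule unitary_mult) (rule unitary_conj_transpose[OF W])
  moreover have "T = U ** conj_by W (rdiag p)"
  proof -
    have d: "rdiag (\<lambda>i. 1 / p i) ** rdiag p = mat 1"
      unfolding mat_eq_diag diag_mult_diag using p(1) by (simp add: less_imp_neq[THEN not_sym])
    have "U ** conj_by W (rdiag p) = X ** (rdiag (\<lambda>i. 1 / p i) ** (conj_transpose W ** W) ** rdiag p) ** conj_transpose W"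
      by (simp add: U_def conj_by_def matrix_mul_assoc)
    also have "\<dots> = X ** conj_transpose W" by (simp only: W' d matrix_mul_rid)
    also have "\<dots> = T" by (simp add: W' X_def flip: matrix_mul_assoc)
    finally show ?thesis by simp
  qed
  ultimately show ?thesis using that W p(1) by blast
qed

text \<open>The phase of \<open>w\<close> is absorbed by the unitary factor and its modulus
  \<open>r\<close> by the positive one. The two powers then contribute
  \<open>r powr l * r powr (1 - l) = r\<close>.\<close>

lemma aluthge_mat_mult:
  fixes T :: "complex^'n^'n"
  assumes "invertible T" "w \<noteq> 0"
  shows "aluthge l (mat w ** T) = mat w ** aluthge l T"
proof -
  obtain W p U where W: "unitary W" and U: "unitary U" and p: "\<And>i. 0 < p i"
    and T: "T = U ** conj_by W (rdiag p)"
    using polar_decomposition[OF assms(1)] by metis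
  define r where "r = cmod w"
  have r: "r > 0" using assms by (simp add: r_def)
  have rw: "of_real r * (w / of_real r) = w" using r by simp
  have "cnj (w / r) * (w / r) = 1"
    using r complex_norm_square[of w] by (simp add: r_def field_simps power2_eq_square)
  then have "unitary (mat (w / r) ** U)"
    by (intro unitary_mult U unitaryI) (simp add: mat_eq_diag conj_transpose_diag diag_mult_diag)
  moreover have D: "rdiag (\<lambda>i. r * q i) = mat (of_real r) ** rdiag q" for q :: "'n \<Rightarrow> real"
    by (simp add: mat_eq_diag diag_mult_diag)
  have mm: "mat a ** mat b = (mat (a * b) :: complex^'n^'n)" for a b :: complex
    by (simp add: mat_eq_diag diag_mult_diag)
  have "mat w ** T = (mat (w / r) ** U) ** conj_by W (rdiag (\<lambda>i. r * p i))"
  proof -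
    have "(mat (w / r) ** U) ** conj_by W (rdiag (\<lambda>i. r * p i)) = mat (w / r) ** (mat r ** U ** conj_by W (rdiag p))"
      unfolding D conj_by_mat_mult by (metis mat_mult_commute matrix_mul_assoc)
    also have "\<dots> = mat w ** T"
      using r by (simp add: T matrix_mul_assoc mm)
    finally show ?thesis by simp
  qed
  ultimately have "aluthge l (mat w ** T) = conj_by W (rdiag (\<lambda>i. (r * p i) powr l)) ** (mat (w / r) ** U)
      ** conj_by W (rdiag (\<lambda>i. (r * p i) powr (1 - l)))"
    using r p by (intro aluthge_polar W) auto
  also have "\<dots> = (mat (r powr l) ** conj_by W (rdiag (\<lambda>i. p i powr l))) ** (mat (w / r) ** U)
      ** (mat (r powr (1 - l)) ** conj_by W (rdiag (\<lambda>i. p i powr (1 - l))))"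
  proof -
    have "rdiag (\<lambda>i. (r * p i) powr s) = mat (r powr s) ** rdiag (\<lambda>i. p i powr s)" for s
      using r p by (simp add: powr_mult less_imp_le mat_eq_diag diag_mult_diag)
    then show ?thesis by (simp only: conj_by_mat_mult)
  qed
  also have "\<dots> = mat (r powr l) ** mat (w / r) ** mat (r powr (1 - l)) ** aluthge l T"
  proof -
    have "A ** (mat z ** B) = mat z ** (A ** B)" for z and A B :: "complex^'n^'n"
      by (metis mat_mult_commute matrix_mul_assoc)
    from this[of U] this[of "conj_by W X" for X] show ?thesis
      unfolding aluthge_polar[OF W U p T] by (simp flip: matrix_mul_assoc)
  qed
  also have "mat (r powr l) ** mat (w / r) ** mat (r powr (1 - l)) = (mat w :: complex^'n^'n)"
  proof -
    have "r powr l * r powr (1 - l) = r" using r by (simp flip: powr_add)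
    then have "complex_of_real (r powr l) * (w / r) * of_real (r powr (1 - l)) = w"
      using r by (metis mult.assoc mult.commute of_real_mult rw)
    then show ?thesis by (simp add: mm)
  qed
  finally show ?thesis .
qed

text \<open>Handles the orbit of the zero matrix, where scaling by a nonzero \<open>w\<close> is
  impossible. The leftmost factor of the transform vanishes because
  \<open>0 powr l = 0\<close>.\<close>

lemma aluthge_0:
  assumes "l \<in> {0<..<1}" shows "aluthge l 0 = (0 :: complex^'n^'n)"
proof -
  have z: "conj_by (mat 1) (rdiag (\<lambda>i. 0)) = (0 :: complex^'n^'n)"
    by (simp add: conj_by_def) (simp add: vec_eq_iff diag_nth)
  have "psd_power 0 s = (0 :: complex^'n^'n)" if "s > 0" for s
    using is_psd_power_conj_by[of "mat 1 :: complex^'n^'n" "\<lambda>_. 0" s] that by (intro psd_power_eqI) (simp add: z[simplified])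
  moreover have "conj_transpose 0 ** 0 = (0 :: complex^'n^'n)" by (simp add: vec_eq_iff matrix_mult_nth)
  ultimately have "matrix_abs 0 = (0 :: complex^'n^'n)" "psd_power 0 l = (0 :: complex^'n^'n)"
    using assms unfolding matrix_abs_def by auto
  moreover have "0 ** A = 0" for A :: "complex^'n^'n" by (simp add: vec_eq_iff matrix_mult_nth)
  ultimately show ?thesis unfolding aluthge_def by simp
qed

section \<open>Matrices with a real quadratic relation\<close>

text \<open>The eigenvalues are among the roots of z^2 - 2 c z + 1. For
  \<open>c\<^sup>2 \<le> 1\<close> these roots are conjugate points of the unit circle with real
  part \<open>c\<close>.\<close>

definition quad_rel :: "real \<Rightarrow> complex^'n^'n \<Rightarrow> bool" where
  "quad_rel c T \<longleftrightarrow> T ** T + mat 1 = (2 * c) *\<^sub>R T"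

definition skew :: "complex^'n^'n \<Rightarrow> complex^'n^'n" where
  "skew A = (1/2) *\<^sub>R (A - conj_transpose A)"

lemma skew_nth: "skew A $ i $ j = (A $ i $ j - cnj (A $ j $ i)) / 2"
  by (simp add: skew_def scaleR_conv_of_real[where 'a = complex])

lemma skew_conj_by: "skew (conj_by V A) = conj_by V (skew A)"
  by (simp add: skew_def conj_transpose_conj_by conj_by_diff conj_by_scaleR)

lemma quad_rel_similar:
  fixes R S T :: "complex^'n^'n"
  assumes T: "quad_rel c T" and SR: "R ** S = mat 1"
  shows "quad_rel c (S ** T ** R)"
proof -
  have "S ** R = mat 1" using SR matrix_left_right_inverse by blast
  then have "(S ** T ** R) ** (S ** T ** R) + mat 1 = S ** (T ** T + mat 1) ** R"
    by (simp add: matrix_add_ldistrib matrix_add_rdistrib) (metis SR matrix_mul_assoc matrix_mul_rid)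
  also have "\<dots> = (2 * c) *\<^sub>R (S ** T ** R)"
    using T by (simp add: quad_rel_def matrix_scalar_ac flip: scalar_matrix_assoc)
  finally show ?thesis by (simp add: quad_rel_def)
qed

lemma quad_rel_conj_by: "quad_rel c T \<Longrightarrow> unitary V \<Longrightarrow> quad_rel c (conj_by V T)"
  unfolding conj_by_def by (rule quad_rel_similar) (simp_all add: unitary_def)

text \<open>The relation can be rewritten as (2 c - T) T = 1, which displays the inverse.\<close>

lemma quad_rel_invertible:
  assumes "quad_rel c T" shows "invertible T"
proof -
  have "((2 * c) *\<^sub>R mat 1 - T) ** T = mat 1"
    using assms by (simp add: quad_rel_def matrix_diff_rdistrib flip: scalar_matrix_assoc)
      (metis add_diff_cancel_left')
  then show ?thesis unfolding invertible_left_inverse by blast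
qed

section \<open>The quadratic relation in an orthonormal eigenbasis of the modulus\<close>

locale quad_polar =
  fixes u :: "complex^'n^'n" and p :: "'n \<Rightarrow> real" and c :: real
  assumes unitary_u: "unitary u" and p_pos: "0 < p i"
    and quad: "quad_rel c (u ** rdiag p)"
begin

text \<open>Multiplying the relation on the left by the adjoint of \<open>u\<close> gives
  \<open>rdiag p ** u ** rdiag p + conj_transpose u = (2 * c) *\<^sub>R rdiag p\<close>. Since
  \<open>rdiag p\<close> is diagonal, this decouples into relations between the entries at
  \<open>i\<close>, \<open>j\<close> and at \<open>j\<close>, \<open>i\<close>.\<close>

lemma entry: "of_real (p i * p j) * u $ i $ j + cnj (u $ j $ i) = (if i = j then of_real (2 * c * p i) else 0)"
proof -
  have "conj_transpose u ** ((u ** rdiag p) ** (u ** rdiag p) + mat 1)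
      = (conj_transpose u ** u) ** rdiag p ** u ** rdiag p + conj_transpose u"
    by (simp add: matrix_add_ldistrib matrix_mul_assoc)
  then have "rdiag p ** u ** rdiag p + conj_transpose u = conj_transpose u ** ((2 * c) *\<^sub>R (u ** rdiag p))"
    using quad unitary_u by (simp add: quad_rel_def unitary_def)
  also have "\<dots> = (2 * c) *\<^sub>R ((conj_transpose u ** u) ** rdiag p)"
    by (simp add: matrix_scalar_ac matrix_mul_assoc flip: scalar_matrix_assoc)
  finally have "rdiag p ** u ** rdiag p + conj_transpose u = (2 * c) *\<^sub>R rdiag p"
    using unitary_u by (simp add: unitary_def)
  then have "(rdiag p ** u ** rdiag p + conj_transpose u) $ i $ j = ((2 * c) *\<^sub>R rdiag p) $ i $ j"
    by simp
  then show ?thesis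
    by (simp add: mult_diag_nth diag_mult_nth diag_nth mult_ac scaleR_conv_of_real[where 'a = complex] split: if_splits)
qed

lemma cosh_ln_p: "cosh (ln (p i)) = ((p i)\<^sup>2 + 1) / (2 * p i)"
  using p_pos[of i] by (simp add: cosh_ln_real field_simps power2_eq_square)

lemma real_part: "Re (u $ i $ i) = c / cosh (ln (p i))"
proof -
  have "p i * p i * Re (u $ i $ i) + Re (u $ i $ i) = 2 * c * p i"
    using arg_cong[OF entry[of i i], of Re] by simp
  moreover have "p i * p i + 1 > 0" using p_pos[of i] by (simp add: add_pos_pos)
  ultimately show ?thesis using p_pos[of i] by (simp add: cosh_ln_p field_simps power2_eq_square)
qed

text \<open>Off the diagonal, \<open>entry\<close> at \<open>i\<close>, \<open>j\<close> and its
  conjugate at \<open>j\<close>, \<open>i\<close> form a homogeneous linear system in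
  \<open>u $ i $ j\<close> and \<open>cnj (u $ j $ i)\<close> with determinant
  \<open>q * q - 1\<close>, so a nonzero solution forces \<open>q = 1\<close>. On the diagonal the
  imaginary part of \<open>entry\<close> does the same. This is the entrywise form of
  anticommutation with the logarithm of the modulus.\<close>

lemma skew_u_support:
  assumes "skew u $ i $ j \<noteq> 0" shows "p i * p j = 1"
proof (cases "i = j")
  case True
  have "p i * p i * Im (u $ i $ i) - Im (u $ i $ i) = 0"
    using arg_cong[OF entry[of i i], of Im] by simp
  then have "(p i * p i - 1) * Im (u $ i $ i) = 0" by (simp add: algebra_simps)
  moreover have "Im (u $ i $ i) \<noteq> 0"
    using assms True by (auto simp: skew_nth complex_eq_iff)
  ultimately show ?thesis using True by simp
next
  case False
  define q where "q = p i * p j"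
  have q: "q > 0" using p_pos by (simp add: q_def)
  have 1: "of_real q * u $ i $ j + cnj (u $ j $ i) = 0" using False entry[of i j] by (simp add: q_def)
  have "cnj (of_real q * u $ j $ i + cnj (u $ i $ j)) = 0" using False entry[of j i] by (simp add: q_def mult.commute)
  then have 2: "of_real q * cnj (u $ j $ i) + u $ i $ j = 0" by simp
  have "(of_real q * of_real q - 1) * u $ i $ j
      = of_real q * (of_real q * u $ i $ j + cnj (u $ j $ i)) - (of_real q * cnj (u $ j $ i) + u $ i $ j)"
    by (simp add: algebra_simps)
  also have "\<dots> = 0" by (simp only: 1 2) simp
  finally have "of_real (q * q - 1) * u $ i $ j = 0" by simp
  moreover have "u $ i $ j \<noteq> 0" using assms 1 q by (auto simp: skew_nth)
  ultimately have "q * q = 1" by (metis mult_eq_0_iff of_real_eq_0_iff eq_iff_diff_eq_0)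
  then show ?thesis using q unfolding q_def[symmetric] by (auto simp: square_eq_1_iff)
qed

text \<open>Where the skew entry is nonzero, \<open>q = 1\<close> turns \<open>entry\<close> into
  skew symmetry. Where it vanishes, \<open>entry\<close> becomes
  \<open>(q + 1) * u $ i $ j = 0\<close>, and positivity of \<open>q\<close> kills the entry. Hence
  the Hermitian part of \<open>u\<close> is diagonal.\<close>

lemma u_off_diagonal:
  assumes "i \<noteq> j" shows "u $ i $ j = skew u $ i $ j" "cnj (u $ j $ i) = - skew u $ i $ j"
proof -
  define q where "q = p i * p j"
  have q: "q > 0" using p_pos by (simp add: q_def)
  have 1: "of_real q * u $ i $ j + cnj (u $ j $ i) = 0" using assms entry[of i j] by (simp add: q_def)
  have "cnj (u $ j $ i) = - u $ i $ j"
  proof (cases "skew u $ i $ j = 0")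
    case True
    then have e: "cnj (u $ j $ i) = u $ i $ j" by (simp add: skew_nth)
    then have "of_real (q + 1) * u $ i $ j = 0" using 1 by (simp add: algebra_simps)
    then have "u $ i $ j = 0" using q by (metis add_pos_pos less_irrefl mult_eq_0_iff of_real_eq_0_iff zero_less_one)
    then show ?thesis using e by simp
  next
    case False
    then have "q = 1" using skew_u_support by (simp add: q_def)
    then show ?thesis using 1 by (simp add: eq_neg_iff_add_eq_0 add.commute)
  qed
  then show "u $ i $ j = skew u $ i $ j" "cnj (u $ j $ i) = - skew u $ i $ j" by (simp_all add: skew_nth)
qed

text \<open>On the support of \<open>skew u\<close> one has \<open>p i = 1 / p j\<close>, so the
  weights of the two conjugate entries are \<open>p j powr (1 - 2 * l)\<close> and its reciprocal,
  whose mean is the hyperbolic cosine. A nonzero diagonal entry forces \<open>p i = 1\<close>, and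
  there every weight is 1.\<close>

lemma skew_aluthge:
  "skew (rdiag (\<lambda>i. p i powr l) ** u ** rdiag (\<lambda>i. p i powr (1 - l)))
     = skew u ** rdiag (\<lambda>j. cosh ((1 - 2 * l) * ln (p j)))"
proof -
  have "(p i powr l * p j powr (1 - l) * u $ i $ j - p j powr l * p i powr (1 - l) * cnj (u $ j $ i)) / 2
      = skew u $ i $ j * cosh ((1 - 2 * l) * ln (p j))" for i j
  proof (cases "i = j")
    case True
    have "p i powr l * p i powr (1 - l) = p i" using p_pos[of i] by (simp flip: powr_add)
    then have "(p i powr l * p i powr (1 - l) * u $ i $ i - p i powr l * p i powr (1 - l) * cnj (u $ i $ i)) / 2
        = p i * skew u $ i $ i"
      by (simp add: skew_nth field_simps flip: of_real_mult)
    moreover have "skew u $ i $ i = 0 \<or> p i = 1"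
      using skew_u_support[of i i] p_pos[of i] by (auto simp: square_eq_1_iff)
    ultimately show ?thesis using True by auto
  next
    case False
    show ?thesis
    proof (cases "skew u $ i $ j = 0")
      case True
      then show ?thesis using u_off_diagonal[OF False] by simp
    next
      case sk: False
      have "p i = 1 / p j" using skew_u_support[OF sk] p_pos[of j] by (simp add: field_simps)
      then have "ln (p i) = - ln (p j)" using p_pos[of j] by (simp add: ln_div)
      then have "p i powr x = exp (- (x * ln (p j)))" for x using p_pos[of i] by (simp add: powr_def)
      moreover have "p j powr x = exp (x * ln (p j))" for x using p_pos[of j] by (simp add: powr_def)
      ultimately have "p i powr l * p j powr (1 - l) + p j powr l * p i powr (1 - l) = 2 * cosh ((1 - 2 * l) * ln (p j))"
        by (simp add: cosh_def algebra_simps flip: exp_add)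
      then have "complex_of_real (p i powr l * p j powr (1 - l) + p j powr l * p i powr (1 - l))
          = of_real (2 * cosh ((1 - 2 * l) * ln (p j)))"
        by simp
      then have "complex_of_real (p i powr l * p j powr (1 - l)) + of_real (p j powr l * p i powr (1 - l))
          = 2 * of_real (cosh ((1 - 2 * l) * ln (p j)))"
        by simp
      moreover have "(x * s - y * - s) / 2 = s * z" if "x + y = 2 * z" for x y s z :: complex
      proof -
        have "x * s - y * - s = (x + y) * s" by (simp add: algebra_simps)
        then show ?thesis by (simp add: that)
      qed
      ultimately show ?thesis unfolding u_off_diagonal[OF False] of_real_mult by blast
    qed
  qed
  then show ?thesis
    by (simp add: vec_eq_iff skew_nth mult_diag_nth diag_mult_nth mult_ac)
qed

text \<open>This is \<open>skew_aluthge\<close> at \<open>l = 0\<close>, where the transformed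
  product is \<open>u ** rdiag p\<close> itself.\<close>

lemma skew_polar: "skew (u ** rdiag p) = skew u ** rdiag (\<lambda>j. cosh (ln (p j)))"
proof -
  have "rdiag (\<lambda>i. p i powr 0) = mat 1" using p_pos by (simp add: mat_eq_diag less_imp_neq[THEN not_sym])
  then show ?thesis using skew_aluthge[of 0] p_pos by (simp add: less_imp_le)
qed

text \<open>Write \<open>u\<close> as a real diagonal \<open>y\<close> plus a skew matrix
  \<open>e\<close> commuting with it. Unitarity gives e^2 = y^2 - 1, and multiplication by the
  squared cosines clears the denominator of \<open>y\<close>. Thus \<open>cosh (ln (p j))\<close>
  becomes a function of the squared skew part.\<close>

lemma skew_polar_sq:
  "skew (u ** rdiag p) ** skew (u ** rdiag p) = rdiag (\<lambda>j. c\<^sup>2 - (cosh (ln (p j)))\<^sup>2)"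
proof -
  define C where "C = (\<lambda>i. cosh (ln (p i)))"
  define y where "y = (\<lambda>i. c / C i)"
  define e where "e = skew u"
  have C0: "C i > 0" for i by (simp add: C_def)
  \<comment> \<open>\<open>cosh\<close> is even, so reciprocal singular values give the same
    \<open>C\<close>. Therefore \<open>e\<close> commutes with diagonal matrices built from
    \<open>C\<close>, although it anticommutes with the logarithm.\<close>
  have Ceq: "C i = C j" if "e $ i $ j \<noteq> 0" for i j
  proof -
    have "p i = 1 / p j" using skew_u_support that p_pos[of j] by (simp add: e_def field_simps)
    then show ?thesis using p_pos[of j] by (simp add: C_def ln_div)
  qed
  have u: "u = rdiag y + e"
  proof -
    have "u $ i $ j = (if i = j then of_real (y i) else 0) + e $ i $ j" for i j
      using u_off_diagonal(1)[of i j] real_part[of i]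
      by (auto simp: e_def y_def C_def skew_nth complex_eq_iff)
    then show ?thesis by (simp add: vec_eq_iff diag_nth)
  qed
  have e': "conj_transpose e = - e" by (auto simp: e_def vec_eq_iff skew_nth field_simps)
  have "rdiag y ** e = e ** rdiag y"
    using Ceq by (auto simp: vec_eq_iff diag_mult_nth mult_diag_nth y_def mult.commute)
  moreover have "conj_transpose u = rdiag y - e"
    by (simp add: vec_eq_iff u diag_nth e'[unfolded vec_eq_iff, simplified])
  ultimately have "u ** conj_transpose u = rdiag y ** rdiag y - e ** e"
    by (simp add: u matrix_add_rdistrib matrix_diff_ldistrib)
  then have "e ** e = rdiag y ** rdiag y - mat 1" using unitary_u by (simp add: unitary_def algebra_simps)
  then have ee: "e ** e = rdiag (\<lambda>i. (y i)\<^sup>2 - 1)"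
    by (simp add: vec_eq_iff diag_mult_diag diag_nth mat_def power2_eq_square)
  have eC: "e ** rdiag C = rdiag C ** e"
    using Ceq by (auto simp: vec_eq_iff diag_mult_nth mult_diag_nth mult.commute) (metis)
  have "(e ** rdiag C) ** (e ** rdiag C) = (e ** e) ** (rdiag C ** rdiag C)"
    by (metis eC matrix_mul_assoc)
  also have "\<dots> = rdiag (\<lambda>j. c\<^sup>2 - (C j)\<^sup>2)"
  proof -
    have "((y j)\<^sup>2 - 1) * (C j * C j) = c\<^sup>2 - (C j)\<^sup>2" for j
      using C0[of j] by (simp add: y_def field_simps power2_eq_square)
    then show ?thesis unfolding ee diag_mult_diag of_real_mult[symmetric] by simp
  qed
  finally show ?thesis unfolding skew_polar e_def[symmetric] C_def .
qed

end

text \<open>If \<open>\<i> k\<close> is an eigenvalue of the skew part and \<open>p\<close> a matching singular value, then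
  \<open>k\<^sup>2 + c\<^sup>2 = cosh\<^sup>2 (ln p)\<close>; the argument \<open>m\<close> is \<open>1 - 2 \<lambda>\<close>.\<close>

definition kappa_step :: "real \<Rightarrow> real \<Rightarrow> real \<Rightarrow> real" where
  "kappa_step c m k = k * (cosh (m * arcosh (sqrt (k\<^sup>2 + c\<^sup>2))) / sqrt (k\<^sup>2 + c\<^sup>2))"

text \<open>The transform is the similarity of \<open>T\<close> by the power \<open>l\<close> of its
  modulus, which preserves the relation. In an eigenbasis of the modulus, the skew part gets
  multiplied by \<open>cosh ((1 - 2 * l) * ln (p j)) / cosh (ln (p j))\<close>. By
  \<open>skew_polar_sq\<close> this multiplier is a function of the squared skew part, so it acts
  diagonally in the basis \<open>V\<close> as well.\<close>

proposition aluthge_quad_rel: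
  fixes T V :: "complex^'n^'n"
  assumes T: "quad_rel c T" and V: "unitary V"
    and skew: "skew T = conj_by V (diag (\<lambda>i. \<i> * of_real (k i)))"
  shows "quad_rel c (aluthge l T)"
    and "skew (aluthge l T) = conj_by V (diag (\<lambda>i. \<i> * of_real (kappa_step c (1 - 2 * l) (k i))))"
proof -
  obtain W p U where W: "unitary W" and U: "unitary U" and p: "\<And>i. 0 < p i"
    and TU: "T = U ** conj_by W (rdiag p)"
    using polar_decomposition[OF quad_rel_invertible[OF T]] by metis
  define u where "u = conj_by (conj_transpose W) U"
  have U': "U = conj_by W u" using W by (simp add: u_def)
  have TW: "T = conj_by W (u ** rdiag p)" unfolding TU U' by (rule conj_by_mult[OF W])
  have "quad_rel c (conj_by (conj_transpose W) T)"
    by (rule quad_rel_conj_by[OF T unitary_conj_transpose[OF W]])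
  then have qt: "quad_rel c (u ** rdiag p)" using W by (simp add: TW)
  interpret quad_polar u p c
    using p qt unitary_conj_by[OF unitary_conj_transpose[OF W] U] by unfold_locales (auto simp: u_def)
  define A where "A = rdiag (\<lambda>i. p i powr l) ** u ** rdiag (\<lambda>i. p i powr (1 - l))"
  have al: "aluthge l T = conj_by W A"
    unfolding aluthge_polar[OF W U p TU] U' A_def by (simp add: conj_by_mult[OF W])
  have pp: "rdiag (\<lambda>i. p i powr (1 - l)) = rdiag p ** rdiag (\<lambda>i. p i powr (- l))"
    unfolding diag_mult_diag using p by (simp add: powr_diff powr_minus field_simps less_imp_le)
  have "A = rdiag (\<lambda>i. p i powr l) ** (u ** rdiag p) ** rdiag (\<lambda>i. p i powr (- l))"
    unfolding A_def pp by (simp add: matrix_mul_assoc)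
  moreover have "rdiag (\<lambda>i. p i powr (- l)) ** rdiag (\<lambda>i. p i powr l) = mat 1"
    using p by (simp add: diag_mult_diag mat_eq_diag less_imp_neq[THEN not_sym] flip: powr_add of_real_mult)
  ultimately have "quad_rel c A" using quad_rel_similar[OF qt] by metis
  then show "quad_rel c (aluthge l T)" unfolding al by (rule quad_rel_conj_by) (rule W)
  \<comment> \<open>\<open>f\<close> expresses the multiplier through an eigenvalue \<open>x\<close>
    of the squared skew part. \<open>arcosh\<close> recovers only the absolute value of
    \<open>ln (p j)\<close>, which suffices since \<open>cosh\<close> is even.\<close>
  define f where "f = (\<lambda>x. cosh ((1 - 2 * l) * arcosh (sqrt (c\<^sup>2 - x))) / sqrt (c\<^sup>2 - x))"
  have f: "f (c\<^sup>2 - (cosh (ln (p j)))\<^sup>2) = cosh ((1 - 2 * l) * ln (p j)) / cosh (ln (p j))" for j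
  proof -
    have "arcosh (cosh (ln (p j))) = \<bar>ln (p j)\<bar>"
      by (metis abs_ge_zero arcosh_cosh_real cosh_real_abs)
    moreover have "cosh ((1 - 2 * l) * \<bar>ln (p j)\<bar>) = cosh ((1 - 2 * l) * ln (p j))"
      by (metis abs_mult abs_idempotent cosh_real_abs)
    ultimately show ?thesis by (simp add: f_def)
  qed
  \<comment> \<open>The squared skew part is diagonalized in both bases \<open>V\<close> and
    \<open>W\<close>, so \<open>f\<close> of it is the same matrix in either description.\<close>
  have "conj_by V (rdiag (\<lambda>i. - (k i)\<^sup>2)) = skew T ** skew T"
    unfolding skew conj_by_mult[OF V] diag_mult_diag
    by (intro arg_cong[where f = "\<lambda>d. conj_by V (diag d)"] ext) (simp add: complex_eq_iff power2_eq_square)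
  also have "\<dots> = conj_by W (rdiag (\<lambda>j. c\<^sup>2 - (cosh (ln (p j)))\<^sup>2))"
    unfolding TW skew_conj_by conj_by_mult[OF W] skew_polar_sq ..
  finally have fc: "conj_by V (rdiag (\<lambda>i. f (- (k i)\<^sup>2))) = conj_by W (rdiag (\<lambda>j. f (c\<^sup>2 - (cosh (ln (p j)))\<^sup>2)))"
    by (rule diagonal_calculus_unique[OF V W])
  have "skew A = skew (u ** rdiag p) ** rdiag (\<lambda>j. f (c\<^sup>2 - (cosh (ln (p j)))\<^sup>2))"
    unfolding A_def skew_aluthge skew_polar f by (simp add: vec_eq_iff mult_diag_nth)
  then have "skew (aluthge l T) = skew T ** conj_by W (rdiag (\<lambda>j. f (c\<^sup>2 - (cosh (ln (p j)))\<^sup>2)))"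
    unfolding al skew_conj_by by (simp add: TW skew_conj_by conj_by_mult[OF W])
  also have "\<dots> = conj_by V (diag (\<lambda>i. \<i> * of_real (k i)) ** rdiag (\<lambda>i. f (- (k i)\<^sup>2)))"
    unfolding fc[symmetric] skew conj_by_mult[OF V] ..
  also have "\<dots> = conj_by V (diag (\<lambda>i. \<i> * of_real (kappa_step c (1 - 2 * l) (k i))))"
    by (simp add: diag_mult_diag f_def kappa_step_def add.commute mult.assoc)
  finally show "skew (aluthge l T) = conj_by V (diag (\<lambda>i. \<i> * of_real (kappa_step c (1 - 2 * l) (k i))))" .
qed

section \<open>Convergence of the iteration\<close>

text \<open>The squares \<open>x n\<close> evolve by \<open>G\<close>, whose multiplier is the
  squared ratio of \<open>cosh (m * t)\<close> to \<open>cosh t\<close> and is at most 1 for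
  \<open>\<bar>m\<bar> < 1\<close>. They decrease and are bounded below, so they tend to a fixed
  point of \<open>G\<close>, which must be the lower bound. For \<open>m = 1 - 2 * l\<close> the
  condition on \<open>m\<close> says that \<open>l\<close> lies strictly between 0 and 1.\<close>

lemma kappa_iteration_tendsto:
  fixes k :: "nat \<Rightarrow> real"
  assumes m: "\<bar>m\<bar> < 1" and c: "c\<^sup>2 \<le> 1"
    and step: "\<And>n. k (Suc n) = kappa_step c m (k n)"
    and ge: "\<And>n. 1 \<le> (k n)\<^sup>2 + c\<^sup>2"
  shows "(\<lambda>n. (k n)\<^sup>2) \<longlonglongrightarrow> 1 - c\<^sup>2" "k \<longlonglongrightarrow> sgn (k 0) * sqrt (1 - c\<^sup>2)"
proof -
  define x where "x = (\<lambda>n. (k n)\<^sup>2)"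
  define t where "t = (\<lambda>y. arcosh (sqrt (y + c\<^sup>2)))"
  define G where "G = (\<lambda>y. y * ((cosh (m * t y))\<^sup>2 / (y + c\<^sup>2)))"
  have cosh_t: "(cosh (t y))\<^sup>2 = y + c\<^sup>2" "t y \<ge> 0" if "1 - c\<^sup>2 \<le> y" for y
    using that by (auto simp: t_def)
  have mt: "\<bar>m * t y\<bar> \<le> t y" if "1 - c\<^sup>2 \<le> y" for y
    using m cosh_t(2)[OF that] by (simp add: abs_mult mult_left_le_one_le)
  have xge: "1 - c\<^sup>2 \<le> x n" for n using ge[of n] by (simp add: x_def)
  have xG: "x (Suc n) = G (x n)" for n
    using xge[of n] by (simp add: x_def step kappa_step_def G_def t_def power_mult_distrib power_divide)
  have "x (Suc n) \<le> x n" for n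
  proof -
    have "cosh (m * t (x n)) \<le> cosh (t (x n))"
      using mt[OF xge[of n]] cosh_t(2)[OF xge[of n]]
      by (metis abs_ge_zero cosh_real_abs cosh_real_nonneg_le_iff)
    then have "(cosh (m * t (x n)))\<^sup>2 \<le> x n + c\<^sup>2"
      using cosh_t(1)[OF xge[of n]] by (metis cosh_real_nonneg power_mono)
    then have "(cosh (m * t (x n)))\<^sup>2 / (x n + c\<^sup>2) \<le> 1"
      using xge[of n] by (simp add: divide_le_eq)
    then show ?thesis
      unfolding xG G_def using xge[of n] c by (intro mult_left_le) auto
  qed
  then have "decseq x" by (rule decseq_SucI)
  then obtain L where L: "x \<longlonglongrightarrow> L"
    using decseq_convergent[of x "1 - c\<^sup>2"] xge by metis
  have Lge: "1 - c\<^sup>2 \<le> L" using L xge by (intro LIMSEQ_le_const) auto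
  have "continuous_on {1 - c\<^sup>2..} G"
    unfolding G_def t_def by (intro continuous_intros) auto
  then have "(\<lambda>n. G (x n)) \<longlonglongrightarrow> G L"
    using L xge Lge by (intro continuous_on_tendsto_compose[of _ G]) auto
  then have "G L = L"
    using LIMSEQ_Suc[OF L] unfolding xG using LIMSEQ_unique by blast
  \<comment> \<open>A nonzero fixed point has multiplier 1, which means \<open>t L = 0\<close>. The
    fixed point 0 is compatible with the lower bound only when \<open>c\<^sup>2 = 1\<close>, and
    then it is the same value.\<close>
  have "L = 1 - c\<^sup>2"
  proof (cases "L = 0")
    case False
    then have "(cosh (m * t L))\<^sup>2 / (L + c\<^sup>2) = 1"
      using \<open>G L = L\<close> unfolding G_def by (simp only: mult_cancel_left2) simp
    then have "(cosh (m * t L))\<^sup>2 = (cosh (t L))\<^sup>2"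
      using Lge cosh_t(1)[OF Lge] by simp
    then have "cosh \<bar>m * t L\<bar> = cosh (t L)" by (simp add: cosh_real_nonneg)
    then have "\<bar>m\<bar> * t L = t L"
      using cosh_t(2)[OF Lge] arcosh_cosh_real[of "\<bar>m * t L\<bar>"] arcosh_cosh_real[of "t L"]
      by (simp add: abs_mult del: cosh_real_abs)
    then have "t L = 0" using m by auto
    then show ?thesis using cosh_t(1)[OF Lge] by simp
  qed (use Lge c in auto)
  with L have lim: "x \<longlonglongrightarrow> 1 - c\<^sup>2" by simp
  then show "(\<lambda>n. (k n)\<^sup>2) \<longlonglongrightarrow> 1 - c\<^sup>2" by (simp add: x_def)
  \<comment> \<open>The multiplier in \<open>kappa_step\<close> is positive, so the limit of the
    squares determines that of \<open>k\<close> up to the initial sign.\<close>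
  have "sgn (k (Suc n)) = sgn (k n)" for n
    using ge[of n] by (auto simp: step kappa_step_def sgn_mult sgn_divide add_pos_pos intro!: sgn_pos)
  then have sgn: "sgn (k n) = sgn (k 0)" for n by (induction n) auto
  have "k n = sgn (k 0) * sqrt (x n)" for n
    using sgn_mult_abs[of "k n"] unfolding sgn[of n] by (simp add: x_def)
  then have "k = (\<lambda>n. sgn (k 0) * sqrt (x n))" by (rule ext)
  moreover have "(\<lambda>n. sgn (k 0) * sqrt (x n)) \<longlonglongrightarrow> sgn (k 0) * sqrt (1 - c\<^sup>2)"
    by (intro tendsto_intros lim)
  ultimately show "k \<longlonglongrightarrow> sgn (k 0) * sqrt (1 - c\<^sup>2)" by metis
qed

text \<open>The relation is equivalent to (t - c)^2 = c^2 - 1. In a basis where the skew part is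
  diagonal, the real part of a diagonal entry of this square is the squared norm of a row of the
  Hermitian remainder minus \<open>(k i)\<^sup>2\<close>. This yields both the lower bound on
  \<open>(k i)\<^sup>2\<close> and the decay of the remainder.\<close>

lemma sum_sq_hermitian_part:
  fixes t :: "complex^'n^'n"
  assumes t: "quad_rel c t" and sk: "skew t = diag (\<lambda>i. \<i> * of_real (k i))"
  shows "(\<Sum>j\<in>UNIV. (cmod ((t - mat c - skew t) $ i $ j))\<^sup>2) = (k i)\<^sup>2 + c\<^sup>2 - 1"
proof -
  define h where "h = t - mat c - skew t"
  define z where "z = t - mat (of_real c)"
  have hh: "h $ j $ i = cnj (h $ i $ j)" for i j
    by (simp add: h_def skew_nth mat_def field_simps)
  have zh: "z $ i $ j = h $ i $ j + (if i = j then \<i> * of_real (k i) else 0)" for i j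
    by (simp add: z_def h_def sk diag_nth)
  have "z ** z = t ** t - t ** mat c - mat c ** t + mat c ** mat (of_real c)"
    by (simp add: z_def matrix_diff_ldistrib matrix_diff_rdistrib)
  then have "(z ** z) $ i $ i = (t ** t + mat 1) $ i $ i - 2 * c * t $ i $ i + c * c - 1"
    by (simp add: mat_eq_diag diag_mult_nth mult_diag_nth diag_nth)
  also have "\<dots> = of_real (c\<^sup>2 - 1)"
    using t by (simp add: quad_rel_def scaleR_conv_of_real[where 'a = complex] power2_eq_square)
  finally have "(\<Sum>j\<in>UNIV. Re (z $ i $ j * z $ j $ i)) = c\<^sup>2 - 1"
    unfolding matrix_mult_nth by (metis Re_complex_of_real Re_sum)
  moreover have "Re (z $ i $ j * z $ j $ i) = (cmod (h $ i $ j))\<^sup>2 - (if j = i then (k i)\<^sup>2 else 0)" for j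
  proof (cases "j = i")
    case True
    have "Im (h $ i $ i) = 0" using hh[of i i] by (simp add: complex_eq_iff)
    then show ?thesis using True unfolding cmod_power2 by (simp add: zh power2_eq_square)
  next
    case False
    then show ?thesis using hh[of j i] unfolding cmod_power2 by (simp add: zh power2_eq_square)
  qed
  ultimately show ?thesis unfolding h_def[symmetric] by (simp only: sum_subtractf sum.delta finite UNIV_I if_True)
qed

lemma aluthge_iter_quad_rel:
  fixes T V :: "complex^'n^'n"
  assumes "quad_rel c T" "unitary V" "skew T = conj_by V (diag (\<lambda>i. \<i> * of_real (k i)))"
  shows "quad_rel c (aluthge_iter l n T) \<and>
    skew (aluthge_iter l n T) = conj_by V (diag (\<lambda>i. \<i> * of_real ((kappa_step c (1 - 2 * l) ^^ n) (k i))))"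
proof (induction n)
  case (Suc n)
  then show ?case
    using aluthge_quad_rel[OF _ assms(2), of c "aluthge_iter l n T"] by (simp add: aluthge_iter_def)
qed (use assms in \<open>simp add: aluthge_iter_def\<close>)

text \<open>Conjugation by \<open>V\<close> makes the skew parts of all iterates diagonal at once,
  so only the scalar iterations \<open>\<kappa> i\<close> and the Hermitian remainder
  \<open>h\<close> have to be followed.\<close>

proposition aluthge_iter_tendsto:
  fixes T V :: "complex^'n^'n"
  assumes T: "quad_rel c T" and V: "unitary V" and skT: "skew T = conj_by V (diag (\<lambda>i. \<i> * of_real (k i)))"
    and c: "c\<^sup>2 \<le> 1" and l: "l \<in> {0<..<1}"
  shows "(\<lambda>n. aluthge_iter l n T) \<longlonglongrightarrow>
    conj_by V (mat c + diag (\<lambda>i. \<i> * of_real (sgn (k i) * sqrt (1 - c\<^sup>2))))"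
proof -
  define t where "t = (\<lambda>n. conj_by (conj_transpose V) (aluthge_iter l n T))"
  define \<kappa> where "\<kappa> = (\<lambda>i n. (kappa_step c (1 - 2 * l) ^^ n) (k i))"
  have quad: "quad_rel c (t n)" for n
    unfolding t_def using aluthge_iter_quad_rel[OF T V skT] V
    by (blast intro: quad_rel_conj_by unitary_conj_transpose)
  have sk: "skew (t n) = diag (\<lambda>i. \<i> * of_real (\<kappa> i n))" for n
    using aluthge_iter_quad_rel[OF T V skT, of l n] V by (simp add: t_def skew_conj_by \<kappa>_def)
  define h where "h = (\<lambda>n. t n - mat c - skew (t n))"
  have hsum: "(\<Sum>j\<in>UNIV. (cmod (h n $ i $ j))\<^sup>2) = (\<kappa> i n)\<^sup>2 + c\<^sup>2 - 1" for i n
    unfolding h_def by (rule sum_sq_hermitian_part[OF quad sk])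
  have "0 \<le> (\<kappa> i n)\<^sup>2 + c\<^sup>2 - 1" for i n
    unfolding hsum[symmetric] by (intro sum_nonneg) auto
  then have ge: "1 \<le> (\<kappa> i n)\<^sup>2 + c\<^sup>2" for i n by (simp add: algebra_simps)
  have lim: "(\<lambda>n. (\<kappa> i n)\<^sup>2) \<longlonglongrightarrow> 1 - c\<^sup>2" "\<kappa> i \<longlonglongrightarrow> sgn (k i) * sqrt (1 - c\<^sup>2)" for i
    using kappa_iteration_tendsto[of "1 - 2 * l" c "\<kappa> i"] l c ge by (auto simp: \<kappa>_def)
  \<comment> \<open>Each entry of \<open>h\<close> is bounded by its row norm, whose square
    \<open>(\<kappa> i n)\<^sup>2 + c\<^sup>2 - 1\<close> tends to 0.\<close>
  have h0: "(\<lambda>n. h n $ i $ j) \<longlonglongrightarrow> 0" for i j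
  proof -
    have "(\<lambda>n. sqrt ((\<kappa> i n)\<^sup>2 + c\<^sup>2 - 1)) \<longlonglongrightarrow> sqrt (1 - c\<^sup>2 + c\<^sup>2 - 1)"
      by (intro tendsto_intros lim)
    moreover have "cmod (h n $ i $ j) \<le> sqrt ((\<kappa> i n)\<^sup>2 + c\<^sup>2 - 1)" for n
      unfolding hsum[symmetric] by (intro real_le_rsqrt member_le_sum) auto
    ultimately show ?thesis
      using Lim_null_comparison[of "\<lambda>n. h n $ i $ j" "\<lambda>n. sqrt ((\<kappa> i n)\<^sup>2 + c\<^sup>2 - 1)"] by simp
  qed
  have "t \<longlonglongrightarrow> mat c + diag (\<lambda>i. \<i> * of_real (sgn (k i) * sqrt (1 - c\<^sup>2)))"
  proof (intro vec_tendstoI)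
    fix i j
    have "(\<lambda>n. \<i> * complex_of_real (\<kappa> i n)) \<longlonglongrightarrow> \<i> * of_real (sgn (k i) * sqrt (1 - c\<^sup>2))"
      by (intro tendsto_intros lim)
    then have "(\<lambda>n. if i = j then \<i> * complex_of_real (\<kappa> i n) else 0)
        \<longlonglongrightarrow> (if i = j then \<i> * of_real (sgn (k i) * sqrt (1 - c\<^sup>2)) else 0)"
      by (cases "i = j") simp_all
    then have "(\<lambda>n. h n $ i $ j + mat (complex_of_real c) $ i $ j + (if i = j then \<i> * of_real (\<kappa> i n) else 0))
      \<longlonglongrightarrow> 0 + mat (complex_of_real c) $ i $ j + (if i = j then \<i> * of_real (sgn (k i) * sqrt (1 - c\<^sup>2)) else 0)"
      by (intro tendsto_add tendsto_const h0)
    moreover have "t n $ i $ j = h n $ i $ j + mat (complex_of_real c) $ i $ j + (if i = j then \<i> * of_real (\<kappa> i n) else 0)" for n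
      by (simp add: h_def sk diag_nth)
    ultimately show "(\<lambda>n. t n $ i $ j) \<longlonglongrightarrow> (mat c + diag (\<lambda>i. \<i> * of_real (sgn (k i) * sqrt (1 - c\<^sup>2)))) $ i $ j"
      by (cases "i = j") (simp_all add: diag_nth)
  qed
  then have "(\<lambda>n. conj_by V (t n)) \<longlonglongrightarrow> conj_by V (mat c + diag (\<lambda>i. \<i> * of_real (sgn (k i) * sqrt (1 - c\<^sup>2))))"
    by (rule tendsto_conj_by)
  then show ?thesis using V by (simp add: t_def)
qed

text \<open>Multiplication by \<open>- \<i>\<close> turns the skew part into a Hermitian
  matrix.\<close>

lemma skew_diagonalization:
  fixes T :: "complex^'n^'n"
  obtains V k where "unitary V" "skew T = conj_by V (diag (\<lambda>i. \<i> * of_real (k i)))"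
proof -
  have "conj_transpose (mat (- \<i>) ** skew T) = mat (- \<i>) ** skew T"
    by (simp add: vec_eq_iff skew_nth mat_eq_diag diag_mult_nth field_simps)
  then obtain V k where V: "unitary V" and "mat (- \<i>) ** skew T = conj_by V (rdiag k)"
    by (rule hermitian_diagonalization)
  then have "mat \<i> ** (mat (- \<i>) ** skew T) = conj_by V (mat \<i> ** rdiag k)"
    by (simp add: conj_by_mat_mult)
  moreover have "mat \<i> ** mat (- \<i>) = (mat 1 :: complex^'n^'n)"
    by (simp add: mat_eq_diag diag_mult_diag)
  moreover have "mat \<i> ** rdiag k = diag (\<lambda>i. \<i> * of_real (k i))"
    by (simp add: mat_eq_diag diag_mult_diag)
  ultimately have "skew T = conj_by V (diag (\<lambda>i. \<i> * of_real (k i)))"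
    by (metis matrix_mul_assoc matrix_mul_lid)
  with V show ?thesis by (rule that)
qed

text \<open>\<open>L\<close> is obtained before \<open>l\<close> is quantified: the eigenbasis
  \<open>V\<close> and the signs of \<open>k\<close> come from \<open>T\<close> alone, so one limit
  serves all \<open>l\<close>.\<close>

lemma aluthge_iter_limit_exists:
  assumes T: "quad_rel c T" and c: "c\<^sup>2 \<le> 1"
  obtains L where "\<And>l. l \<in> {0<..<1} \<Longrightarrow> (\<lambda>n. aluthge_iter l n (mat w ** T)) \<longlonglongrightarrow> L"
proof (cases "w = 0")
  case True
  then have z: "mat w ** T = 0" by (simp add: vec_eq_iff mat_eq_diag diag_mult_nth)
  have "aluthge_iter l n (mat w ** T) = 0" if "l \<in> {0<..<1}" for l n
    by (induction n) (use that in \<open>simp_all add: aluthge_iter_def aluthge_0 z\<close>)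
  then show ?thesis by (intro that[of 0]) simp
next
  case False
  obtain V k where Vk: "unitary V" "skew T = conj_by V (diag (\<lambda>i. \<i> * of_real (k i)))"
    by (rule skew_diagonalization)
  have it: "aluthge_iter l n (mat w ** T) = mat w ** aluthge_iter l n T" for l n
  proof (induction n)
    case (Suc n)
    have "invertible (aluthge_iter l n T)"
      using aluthge_iter_quad_rel[OF T Vk] quad_rel_invertible by blast
    with Suc False show ?case by (simp add: aluthge_iter_def aluthge_mat_mult)
  qed (simp add: aluthge_iter_def)
  define L where "L = conj_by V (mat c + diag (\<lambda>i. \<i> * of_real (sgn (k i) * sqrt (1 - c\<^sup>2))))"
  have "(\<lambda>n. mat w ** aluthge_iter l n T) \<longlonglongrightarrow> mat w ** L" if "l \<in> {0<..<1}" for l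
    using aluthge_iter_tendsto[OF T Vk c that] unfolding L_def[symmetric]
    by (intro vec_tendstoI) (auto simp: mat_eq_diag diag_mult_nth intro!: tendsto_intros tendsto_vec_nth)
  then show ?thesis unfolding it[symmetric] by (rule that)
qed

section \<open>Reduction of the similarity orbit to the quadratic relation\<close>

lemma spectrum_diag_entry:
  assumes "is_diagonal D" shows "D $ i $ i \<in> spectrum D"
proof -
  have "row i (D - mat (D $ i $ i)) = 0"
    using assms by (auto simp: vec_eq_iff row_def mat_def is_diagonal_def)
  then have "det (D - mat (D $ i $ i)) = 0" by (rule det_zero_row)
  then show ?thesis by (simp add: spectrum_def invertible_det_nz)
qed

text \<open>For nonzero eigenvalues take \<open>w\<close> with \<open>w * w = d1 * d2\<close>. Equal
  moduli give \<open>cmod w = cmod d1\<close>, so \<open>a = d1 / w\<close> and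
  \<open>b = d2 / w\<close> have modulus 1 and product 1 and are conjugate. Both are roots of z^2 -
  (a + b) z + 1, and \<open>a + b\<close> is twice the real number \<open>c = Re a\<close>.\<close>

lemma similarity_orbit_quad_rel:
  fixes D T :: "complex^'n^'n"
  assumes D: "is_diagonal D" and sp: "spectrum D = {d1, d2}" and eq: "cmod d1 = cmod d2"
    and T: "T \<in> similarity_orbit D"
  obtains w c T0 where "T = mat w ** T0" "quad_rel c T0" "c\<^sup>2 \<le> 1"
proof -
  define d where "d = (\<lambda>i. D $ i $ i)"
  have Dd: "D = diag d" using D by (auto simp: vec_eq_iff d_def diag_nth is_diagonal_def)
  have d: "d i = d1 \<or> d i = d2" for i
    using spectrum_diag_entry[OF D, of i] sp by (simp add: d_def)
  obtain S where S: "invertible S" and TS: "T = S ** D ** matrix_inv S"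
    using T by (auto simp: similarity_orbit_def)
  have SS: "matrix_inv S ** S = mat 1" 
    using S someI_ex unfolding invertible_def matrix_inv_def by (metis (mono_tags, lifting))
  obtain w c D0 where w: "D = mat w ** D0" "quad_rel c (D0 :: complex^'n^'n)" "c\<^sup>2 \<le> 1"
  proof (cases "d1 = 0")
    case True
    \<comment> \<open>Here \<open>d2\<close> is 0 too, so \<open>D\<close> is the zero matrix. It is
      written as 0 times the identity, which satisfies the relation with
      \<open>c = 1\<close>.\<close>
    then have "d = (\<lambda>_. 0)" using d eq by (metis norm_zero zero_less_norm_iff less_irrefl)
    then have "D = mat 0 ** mat 1" by (simp add: Dd mat_eq_diag diag_mult_diag)
    moreover have "quad_rel 1 (mat 1 :: complex^'n^'n)"
      by (simp add: quad_rel_def scaleR_2)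
    ultimately show ?thesis using that[of 0 "mat 1" 1] by simp
  next
    case False
    define w where "w = csqrt (d1 * d2)"
    have d2: "d2 \<noteq> 0" using False eq by auto
    have ww: "w * w = d1 * d2" unfolding w_def by (metis power2_csqrt power2_eq_square)
    have w0: "w \<noteq> 0" using False d2 by (simp add: w_def)
    define a where "a = d1 / w"
    have "cmod w * cmod w = cmod d1 * cmod d1" using ww eq by (metis norm_mult)
    then have "cmod w = cmod d1" by (metis norm_ge_zero real_sqrt_abs2 abs_of_nonneg)
    then have na: "cmod a = 1" using w0 False by (simp add: a_def norm_divide)
    define b where "b = d2 / w"
    have ab: "a * b = 1" using ww w0 False d2 by (simp add: a_def b_def)
    have "a * cnj a = 1" using na by (simp flip: complex_norm_square)
    with ab have "b = cnj a" using na by (metis mult_cancel_left norm_zero zero_neq_one)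
    then have trace: "2 * of_real (Re a) = a + b" by (simp add: complex_add_cnj)
    have "quad_rel (Re a) (diag (\<lambda>i. d i / w))"
    proof -
      have "a * a + 1 = (a + b) * a" "b * b + 1 = (a + b) * b"
        using ab by (simp_all add: algebra_simps)
      moreover have "d i / w = a \<or> d i / w = b" for i using d[of i] by (auto simp: a_def b_def)
      ultimately have "d i / w * (d i / w) + 1 = 2 * of_real (Re a) * (d i / w)" for i
        unfolding trace by metis
      then show ?thesis
        by (simp add: quad_rel_def diag_mult_diag vec_eq_iff diag_nth mat_def scaleR_conv_of_real[where 'a = complex])
    qed
    moreover have "(Re a)\<^sup>2 \<le> 1"
      using abs_Re_le_cmod[of a] na by (simp add: abs_square_le_1)
    moreover have "D = mat w ** diag (\<lambda>i. d i / w)" using w0 by (simp add: Dd mat_eq_diag diag_mult_diag)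
    ultimately show ?thesis using that by blast
  qed
  have "T = mat w ** (S ** D0 ** matrix_inv S)"
    unfolding TS w(1) by (metis mat_mult_commute matrix_mul_assoc)
  moreover have "quad_rel c (S ** D0 ** matrix_inv S)" by (rule quad_rel_similar[OF w(2) SS])
  ultimately show ?thesis using w(3) by (rule that)
qed

theorem proposition4p4p6:
  fixes D T :: "complex^'n^'n" and d1 d2 :: complex
  assumes "is_diagonal D"
    and "spectrum D = {d1, d2}"
    and "cmod d1 = cmod d2"
    and "T \<in> similarity_orbit D"
  shows "(\<forall>l\<in>{0<..<1}. convergent (\<lambda>n. aluthge_iter l n T)) \<and>
         (\<lambda>l. aluthge_limit l T) constant_on {0<..<1}"
proof -
  obtain w c T0 where T: "T = mat w ** T0" and T0: "quad_rel c T0" and c: "c\<^sup>2 \<le> 1"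
    using similarity_orbit_quad_rel[OF assms] by metis
  obtain L where L: "\<And>l. l \<in> {0<..<1} \<Longrightarrow> (\<lambda>n. aluthge_iter l n T) \<longlonglongrightarrow> L"
    unfolding T using aluthge_iter_limit_exists[OF T0 c] by metis
  then have "aluthge_limit l T = L" if "l \<in> {0<..<1}" for l
    using that unfolding aluthge_limit_def by (intro limI)
  then have "(\<lambda>l. aluthge_limit l T) constant_on {0<..<1}"
    unfolding constant_on_def by blast
  with convergentI[OF L] show ?thesis by blast
qed

end
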